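(* Let $\mathcal{D}$ be a distribution over samples $(\bm{x},y)$ and $\ell(\bm{w},\bm{x},y)$ a loss differentiable in $\bm{w}\in\mathbb{R}^d$. Suppose there is a function $G(\bm{x},y)\ge0$ with $\|\nabla_{\bm{w}}\ell(\bm{w},\bm{x},y)\|\le G(\bm{x},y)$ for all $\bm{w}\in\mathbb{R}^d$ and all $(\bm{x},y)$ in the support of $\mathcal{D}$, and that for some $k>1$ and $G>0$, $\left(\mathbb{E}_{(\bm{x},y)\sim\mathcal{D}}[G(\bm{x},y)^k]\right)^{1/k}\le G$. Let $\mathcal{Z}=\{(\bm{x}_i,y_i)\}_{i=1}^n$ be i.i.d. from $\mathcal{D}$, $f_i(\bm{w})=\ell(\bm{w},\bm{x}_i,y_i)$, $f=\frac1n\sum_if_i$; suppose $f$ is $L$-smooth (i.e. $\|\nabla f(\bm{w})-\nabla f(\bm{w}')\|\le L\|\bm{w}-\bm{w}'\|$) and attains its minimum on $\mathbb{R}^d$, and take $\mathcal{W}=\mathbb{R}^d$. Fix $\gamma\in(0,1)$, $C>0$, $T\ge1$, and run DP-SGD with $\tau=G\left(\frac{G}{\gamma^2C\sqrt L}\right)^{\frac1{2k-1}}\left(\frac1T+\varphi^2\right)^{-\frac1{2(2k-1)}}$, $\eta_t=\eta=\frac{C}{T\tau\sqrt L}\left(\frac1T+\varphi^2\right)^{-\frac12}$ for all $t<T$, and $\sigma_n^2=\frac{\nu T\log(1/\delta)\tau^2}{n^2\varepsilon^2}$. Then with probability at least $1-\gamma$ over the random dataset $\mathcal{Z}$, $$\mathrm{OR}(T)\le\frac{(\sqrt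 L)^{1-\frac1{2k-1}}G^{1+\frac1{2k-1}}}{\gamma^{\frac2{2k-1}}C^{\frac1{2k-1}}}\left(3C+\frac{2(f(\bm{w}_0)-\min_{\bm{w}\in\mathbb{R}^d}f(\bm{w}))}{C}\right)\left(\frac1T+\varphi^2\right)^{\frac12(1-\frac1{2k-1})}.$$ In particular, for $T=\frac1{\varphi^2}$, $$\mathrm{OR}(T)\le\frac{(\sqrt{2L})^{1-\frac1{2k-1}}G^{1+\frac1{2k-1}}}{\gamma^{\frac2{2k-1}}C^{\frac1{2k-1}}}\left(3C+\frac{2(f(\bm{w}_0)-\min_{\bm{w}}f(\bm{w}))}{C}\right)\varphi^{1-\frac1{2k-1}}.$$
   Context: For $\bm{z}\in\mathbb{R}^d$ and $c>0$, $\mathrm{clip}(\bm{z},c)=\bm{z}\min(1,c/\|\bm{z}\|)$ ($\|\cdot\|$ Euclidean). DP-SGD (unconstrained): given $\bm{w}_0\in\mathbb{R}^d$, $T$, step sizes $\eta_t$, a parameter $b\ge1$, clip norm $\tau$, noise variance $\sigma_n^2$: for $t=0,\dots,T-1$, form $\mathcal{S}_t\subseteq[n]$ by including each index independently with probability $b/n$; $\bm{g}_t=\frac1b\sum_{i\in\mathcal{S}_t}\mathrm{clip}(\nabla f_i(\bm{w}_t),\tau)+\bm{\zeta}_t$, $\bm{\zeta}_t\sim\mathcal{N}(\bm{0},\sigma_n^2I_d)$ independent; $\bm{w}_{t+1}=\bm{w}_t-\eta_t\bm{g}_t$. Output $\bm{w}_{\mathrm{priv}}=\bm{w}_{\widehat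 t}$, $\widehat t$ uniform on $\{0,\dots,T-1\}$. Here $\varepsilon>0$, $\delta\in(0,1)$, $\nu>0$ a fixed absolute constant, $\varphi=\frac{\sqrt{\nu d\log(1/\delta)}}{n\varepsilon}$. The (nonconvex) optimization risk is $\mathrm{OR}(T)=\mathbb{E}[\|\nabla f(\bm{w}_{\mathrm{priv}})\|^2]$, the expectation over the algorithm's randomness conditional on $\mathcal{Z}$. *)

theory Defs
  imports "HOL-Probability.Probability"
begin

definition clip :: "'a::real_normed_vector \<Rightarrow> real \<Rightarrow> 'a" where
  "clip z c = min 1 (c / norm z) *\<^sub>R z"

text \<open>Empirical risk f = (1/n) sum f_i with f_i w = loss w (Z i), and its gradient
  (given that gl w z is the gradient of loss at w).\<close>
definition emp_risk :: "('a \<Rightarrow> 'z \<Rightarrow> real) \<Rightarrow> (nat \<Rightarrow> 'z) \<Rightarrow> nat \<Rightarrow> 'a \<Rightarrow> real" where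
  "emp_risk loss Z n w = (1 / real n) * (\<Sum>i<n. loss w (Z i))"

definition emp_grad :: "('a \<Rightarrow> 'z \<Rightarrow> 'a::real_vector) \<Rightarrow> (nat \<Rightarrow> 'z) \<Rightarrow> nat \<Rightarrow> 'a \<Rightarrow> 'a" where
  "emp_grad gl Z n w = (1 / real n) *\<^sub>R (\<Sum>i<n. gl w (Z i))"

definition gauss_vec :: "real \<Rightarrow> 'a::euclidean_space measure" where
  "gauss_vec s2 = distr (PiM Basis (\<lambda>_. density lborel (normal_density 0 (sqrt s2)))) borel
      (\<lambda>x. \<Sum>b\<in>Basis. x b *\<^sub>R b)"

text \<open>DP-SGD iterates, as a deterministic function of the randomness:
  S t i = (index i included in S_t), zeta t = Gaussian noise at step t.\<close>
primrec dpsgd_iter :: "('a \<Rightarrow> 'z \<Rightarrow> 'a::real_normed_vector) \<Rightarrow> (nat \<Rightarrow> 'z) \<Rightarrow> nat \<Rightarrow> real \<Rightarrow> real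
    \<Rightarrow> (nat \<Rightarrow> real) \<Rightarrow> 'a \<Rightarrow> (nat \<Rightarrow> nat \<Rightarrow> bool) \<Rightarrow> (nat \<Rightarrow> 'a) \<Rightarrow> nat \<Rightarrow> 'a" where
  "dpsgd_iter gl Z n b \<tau> \<eta> w0 S \<zeta> 0 = w0"
| "dpsgd_iter gl Z n b \<tau> \<eta> w0 S \<zeta> (Suc t) =
     (let w = dpsgd_iter gl Z n b \<tau> \<eta> w0 S \<zeta> t
      in w - \<eta> t *\<^sub>R ((1 / b) *\<^sub>R (\<Sum>i\<in>{i. i < n \<and> S t i}. clip (gl w (Z i)) \<tau>) + \<zeta> t))"

text \<open>Probability space of the algorithm's randomness:
  ((subset indicators for t<T, i<n, each Bernoulli(b/n) independent),
   (noise vectors for t<T, i.i.d. N(0, s2 I))), and the output index uniform on {0..T-1}.\<close>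
definition dpsgd_rand :: "nat \<Rightarrow> nat \<Rightarrow> real \<Rightarrow> real
    \<Rightarrow> (((nat \<Rightarrow> nat \<Rightarrow> bool) \<times> (nat \<Rightarrow> 'a::euclidean_space)) \<times> nat) measure" where
  "dpsgd_rand n T b s2 =
     pair_measure
       (pair_measure (PiM {..<T} (\<lambda>_. PiM {..<n} (\<lambda>_. measure_pmf (bernoulli_pmf (b / real n)))))
                     (PiM {..<T} (\<lambda>_. gauss_vec s2)))
       (measure_pmf (pmf_of_set {..<T}))"

definition dpsgd_OR :: "('a \<Rightarrow> 'z \<Rightarrow> 'a::euclidean_space) \<Rightarrow> (nat \<Rightarrow> 'z) \<Rightarrow> nat \<Rightarrow> real \<Rightarrow> real
    \<Rightarrow> (nat \<Rightarrow> real) \<Rightarrow> real \<Rightarrow> 'a \<Rightarrow> nat \<Rightarrow> ennreal" where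
  "dpsgd_OR gl Z n b \<tau> \<eta> s2 w0 T =
     (\<integral>\<^sup>+ \<omega>. ennreal ((norm (emp_grad gl Z n
          (dpsgd_iter gl Z n b \<tau> \<eta> w0 (fst (fst \<omega>)) (snd (fst \<omega>)) (snd \<omega>))))\<^sup>2)
      \<partial>(dpsgd_rand n T b s2))"

end

(* Smoothness turns each noisy step into a descent of f up to the second moment of the update and
   the bias of clipping; since 2 <a, b> = |a|^2 + |b|^2 - |a - b|^2, only the square of the bias
   enters. The bias is at most the empirical mean of (G_i - tau)_+ <= G_i^k / tau^(k-1), which
   Markov's inequality bounds by G^k / (gamma tau^(k-1)) with probability at least 1 - gamma over
   the data. Summing the descent over the T steps and inserting tau makes the squared bias
   equal to tau C sqrt(L) sqrt(1/T + phi^2), the common scale of the other terms. *)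
theory Submission
  imports Defs
begin

text \<open>Clipping bounds the second moment of the update whatever the true gradient is, so
  nothing has to be absorbed into the descent term and any \<eta> > 0 is admissible. The constant 3
  C splits accordingly: C is the squared bias and 2 C the second moment of the update, in which the
  noise accounts for d \<sigma>2 = T \<phi>^2 \<tau>^2. The initial gap enters through division by T
  \<eta>.

  Integrability of f and of the squared gradient along the iterates is not known beforehand. Their
  expectations are therefore taken as nonnegative integrals in \<open>ennreal\<close>, f is shifted
  by its minimum to be nonnegative, and inequalities stay additive, with the gradient term on the
  smaller side, because subtraction in \<open>ennreal\<close> is truncated. The bias bound must hold
  for all w simultaneously on one event, since the iterates depend on the data; the envelope G_i
  supplies this uniformity.\<close>

section \<open>Smoothness, gradients and clipping\<close>

lemma smooth_upper_bound:
  fixes f :: "'a::real_inner \<Rightarrow> real"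
  assumes deriv: "\<And>w. (f has_derivative (\<lambda>h. g w \<bullet> h)) (at w)"
    and lip: "\<And>w w'. norm (g w - g w') \<le> L * norm (w - w')"
  shows "f (w + v) \<le> f w + g w \<bullet> v + L / 2 * (norm v)\<^sup>2"
proof -
  \<comment> \<open>On the segment from w to w + v, \<open>q\<close> is f minus the non-constant
    part of its quadratic bound. The Lipschitz condition makes its derivative nonpositive for t
    \<ge> 0, and \<open>q 1 \<le> q 0\<close> is the claim.\<close>
  define q where "q t = f (w + t *\<^sub>R v) - t * (g w \<bullet> v) - L / 2 * t\<^sup>2 * (norm v)\<^sup>2" for t
  have "((\<lambda>t. f (w + t *\<^sub>R v)) has_derivative (\<lambda>h. g (w + t *\<^sub>R v) \<bullet> (h *\<^sub>R v))) (at t)" for t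
    by (rule has_derivative_compose[of "\<lambda>t. w + t *\<^sub>R v" _ _ _ f, OF _ deriv])
       (auto intro!: derivative_eq_intros)
  then have f_line: "((\<lambda>t. f (w + t *\<^sub>R v)) has_real_derivative g (w + t *\<^sub>R v) \<bullet> v) (at t)" for t
    by (simp add: has_field_derivative_def mult_commute_abs)
  have q_deriv: "(q has_real_derivative
      g (w + t *\<^sub>R v) \<bullet> v - g w \<bullet> v - L * t * (norm v)\<^sup>2) (at t)" for t
    unfolding q_def by (rule derivative_eq_intros f_line refl | simp)+
  have "q 1 \<le> q 0"
  proof (rule DERIV_nonpos_imp_nonincreasing[of 0 1 q])
    fix t :: real
    assume "0 \<le> t"
    have "(g (w + t *\<^sub>R v) - g w) \<bullet> v \<le> norm (g (w + t *\<^sub>R v) - g w) * norm v"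
      by (rule norm_cauchy_schwarz)
    also have "\<dots> \<le> (L * norm (t *\<^sub>R v)) * norm v"
      using lip[of "w + t *\<^sub>R v" w] by (intro mult_right_mono) auto
    finally have "g (w + t *\<^sub>R v) \<bullet> v - g w \<bullet> v - L * t * (norm v)\<^sup>2 \<le> 0"
      using \<open>0 \<le> t\<close> by (simp add: inner_diff_left power2_eq_square mult.assoc)
    then show "\<exists>y. (q has_real_derivative y) (at t) \<and> y \<le> 0"
      using q_deriv by blast
  qed simp
  then show ?thesis
    by (simp add: q_def)
qed

text \<open>No continuity of the gradient is available, but it is a pointwise limit of difference
  quotients.\<close>
lemma borel_measurable_gradient:
  fixes f :: "'a::euclidean_space \<Rightarrow> real"
  assumes deriv: "\<And>w. (f has_derivative (\<lambda>h. g w \<bullet> h)) (at w)"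
  shows "g \<in> borel_measurable borel"
proof (subst borel_measurable_euclidean_space, intro ballI)
  fix e :: 'a
  have cont: "continuous_on UNIV f"
    by (meson continuous_at_imp_continuous_on deriv has_derivative_continuous)
  show "(\<lambda>w. g w \<bullet> e) \<in> borel_measurable borel"
  proof (rule borel_measurable_LIMSEQ_real)
    show "(\<lambda>w. (f (w + inverse (real (Suc m)) *\<^sub>R e) - f w) / inverse (real (Suc m)))
        \<in> borel_measurable borel" for m
      by (intro borel_measurable_continuous_onI continuous_intros continuous_on_compose2[OF cont])
         auto
    fix w
    have "((\<lambda>t. f (w + t *\<^sub>R e)) has_derivative (\<lambda>h. g (w + 0 *\<^sub>R e) \<bullet> (h *\<^sub>R e))) (at 0)"
      by (rule has_derivative_compose[of "\<lambda>t. w + t *\<^sub>R e" _ _ _ f, OF _ deriv])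
         (auto intro!: derivative_eq_intros)
    then have "((\<lambda>t. f (w + t *\<^sub>R e)) has_real_derivative g w \<bullet> e) (at 0)"
      by (simp add: has_field_derivative_def mult_commute_abs)
    then have "((\<lambda>h. (f (w + h *\<^sub>R e) - f w) / h) \<longlongrightarrow> g w \<bullet> e) (at 0)"
      by (simp add: DERIV_def)
    moreover have "filterlim (\<lambda>m. inverse (real (Suc m))) (at 0) sequentially"
      using LIMSEQ_inverse_real_of_nat by (simp add: filterlim_at)
    ultimately show "(\<lambda>m. (f (w + inverse (real (Suc m)) *\<^sub>R e) - f w) / inverse (real (Suc m)))
        \<longlonglongrightarrow> g w \<bullet> e"
      by (rule filterlim_compose)
  qed
qed

lemma norm_clip_le:
  assumes "c \<ge> 0"
  shows "norm (clip z c) \<le> c"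
\<comment> \<open>At z = 0 the quotient c / norm z is 0 by convention, and \<open>clip\<close>
  returns 0 whatever its factor.\<close>
proof (cases "z = 0")
  case False
  then have "norm (clip z c) = min (norm z) c"
    using assms by (simp add: clip_def abs_of_nonneg min_mult_distrib_right)
  then show ?thesis by simp
qed (use assms in \<open>simp add: clip_def\<close>)

lemma norm_clip_diff:
  assumes "c \<ge> 0"
  shows "norm (z - clip z c) = max 0 (norm z - c)"
proof (cases "z = 0")
  case False
  have "z - clip z c = (1 - min 1 (c / norm z)) *\<^sub>R z"
    by (simp add: clip_def scaleR_diff_left)
  then have "norm (z - clip z c) = (1 - min 1 (c / norm z)) * norm z"
    by simp
  also have "\<dots> = norm z - min (norm z) c"
    using False by (simp add: left_diff_distrib min_mult_distrib_right)
  finally show ?thesis by linarith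
qed (use assms in \<open>simp add: clip_def\<close>)

lemma borel_measurable_clip [measurable]:
  "(\<lambda>z::'a::euclidean_space. clip z c) \<in> borel_measurable borel"
  unfolding clip_def by measurable

text \<open>Where the excess is positive it is at most x, and x > \<tau> gives \<tau>^(k-1) \<le>
  x^(k-1). This converts the k-th moment of the envelope into a bound on the clipping bias.\<close>

lemma excess_le_powr:
  fixes x \<tau> k :: real
  assumes "x \<ge> 0" "\<tau> > 0" "k \<ge> 1"
  shows "max 0 (x - \<tau>) \<le> x powr k / \<tau> powr (k - 1)"
proof (cases "x \<le> \<tau>")
  case False
  then have "x * \<tau> powr (k - 1) \<le> x * x powr (k - 1)"
    using assms by (intro mult_left_mono powr_mono2) auto
  also have "\<dots> = x powr k"
    using False assms powr_add[of x 1 "k - 1"] by simp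
  finally show ?thesis
    using False assms by (simp add: field_simps max_def) (smt (verit) powr_gt_zero mult_nonneg_nonneg)
qed simp

section \<open>Moments of the Gaussian noise and of the random minibatch\<close>

text \<open>The law of coordinate i is \<open>M i\<close>. Phrasing moments with
  \<open>has_bochner_integral\<close> carries integrability along with the value, so linear
  combinations follow from introduction rules alone.\<close>

lemma has_bochner_integral_PiM_component:
  fixes f :: "'b \<Rightarrow> real"
  assumes "\<And>i. i \<in> I \<Longrightarrow> prob_space (M i)" "i \<in> I" "has_bochner_integral (M i) f x"
  shows "has_bochner_integral (PiM I M) (\<lambda>\<omega>. f (\<omega> i)) x"
proof -
  have f: "f \<in> borel_measurable (M i)"
    using assms(3) by (rule borel_measurable_has_bochner_integral)
  have *: "distr (PiM I M) (M i) (\<lambda>\<omega>. \<omega> i) = M i"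
    using assms(1,2) by (rule distr_PiM_component)
  have "has_bochner_integral (distr (PiM I M) (M i) (\<lambda>\<omega>. \<omega> i)) f x"
    unfolding * by (rule assms(3))
  then show ?thesis
    using f \<open>i \<in> I\<close>
    by (simp add: has_bochner_integral_iff integrable_distr_eq integral_distr)
qed

lemma sets_gauss_vec [simp, measurable_cong]: "sets (gauss_vec s2) = sets borel"
  and space_gauss_vec [simp]: "space (gauss_vec s2) = UNIV"
  by (simp_all add: gauss_vec_def)

lemma prob_space_gauss_vec:
  assumes "s2 > 0"
  shows "prob_space (gauss_vec s2 :: 'a::euclidean_space measure)"
proof -
  have "prob_space (PiM (Basis :: 'a set) (\<lambda>_. density lborel (normal_density 0 (sqrt s2))))"
    using assms by (intro prob_space_PiM prob_space_normal_density) auto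
  then show ?thesis
    unfolding gauss_vec_def by (intro prob_space.prob_space_distr) auto
qed

lemma gauss_vec_moments:
  fixes v :: "'a::euclidean_space" and s2 :: real
  assumes "s2 > 0"
  shows "has_bochner_integral (gauss_vec s2) (\<lambda>z::'a::euclidean_space. v \<bullet> z) 0"
    and "has_bochner_integral (gauss_vec s2) (\<lambda>z::'a::euclidean_space. (norm z)\<^sup>2) (DIM('a) * s2)"
proof -
  let ?N = "density lborel (normal_density 0 (sqrt s2))"
  let ?P = "PiM (Basis :: 'a set) (\<lambda>_. ?N)"
  let ?g = "\<lambda>x. \<Sum>b\<in>Basis. x b *\<^sub>R b :: 'a"
  have sq: "sqrt s2 > 0" using assms by simp
  have prob: "prob_space ?N" using sq by (rule prob_space_normal_density)
  have m1: "has_bochner_integral ?N (\<lambda>x. x) 0"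
    using normal_moment_nz_1[OF sq, of 0]
    by (intro has_bochner_integral_density) (auto simp: normal_density_nonneg)
  \<comment> \<open>The even-moment formula at index 1 is the variance.\<close>
  have m2: "has_bochner_integral ?N (\<lambda>x. x\<^sup>2) s2"
    using normal_moment_even[OF sq, of 0 1] assms
    by (intro has_bochner_integral_density) (auto simp: normal_density_nonneg fact_numeral)
  have c1: "has_bochner_integral ?P (\<lambda>x. x b) 0"
    and c2: "has_bochner_integral ?P (\<lambda>x. (x b)\<^sup>2) s2" if "b \<in> Basis" for b
    using has_bochner_integral_PiM_component[of Basis "\<lambda>_. ?N", OF prob that m1]
      has_bochner_integral_PiM_component[of Basis "\<lambda>_. ?N", OF prob that m2] by auto
  have *: "has_bochner_integral (gauss_vec s2) h x" if "h \<in> borel_measurable borel"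
    and "has_bochner_integral ?P (\<lambda>x. h (?g x)) x" for h :: "'a \<Rightarrow> real" and x
    using that unfolding gauss_vec_def
    by (simp add: has_bochner_integral_iff integrable_distr_eq integral_distr)
  have "has_bochner_integral ?P (\<lambda>x. \<Sum>b\<in>Basis. x b * (v \<bullet> b)) (\<Sum>b\<in>(Basis::'a set). 0 * (v \<bullet> b))"
    by (intro has_bochner_integral_sum has_bochner_integral_mult_left c1)
  then show "has_bochner_integral (gauss_vec s2) (\<lambda>z. v \<bullet> z) 0"
    by (intro *) (auto simp: inner_sum_right)
  have "has_bochner_integral ?P (\<lambda>x. \<Sum>b\<in>Basis. (x b)\<^sup>2) (\<Sum>b\<in>(Basis::'a set). s2)"
    by (intro has_bochner_integral_sum c2)
  moreover have "(norm (?g x))\<^sup>2 = (\<Sum>b\<in>Basis. (x b)\<^sup>2)" for x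
    by (simp only: power2_norm_eq_inner, subst euclidean_inner)
       (simp add: inner_sum_left_Basis power2_eq_square)
  ultimately show "has_bochner_integral (gauss_vec s2) (\<lambda>z::'a. (norm z)\<^sup>2) (DIM('a) * s2)"
    by (intro *) auto
qed

text \<open>Independence of the inclusions: a singleton J yields their means, a two-element J their
  mixed second moments.\<close>

lemma has_bochner_integral_PiM_bernoulli:
  assumes "finite I" "J \<subseteq> I" "0 \<le> p" "p \<le> 1"
  shows "has_bochner_integral (PiM I (\<lambda>_. measure_pmf (bernoulli_pmf p)))
           (\<lambda>s. \<Prod>i\<in>J. of_bool (s i) :: real) (p ^ card J)"
proof -
  interpret product_sigma_finite "\<lambda>_. measure_pmf (bernoulli_pmf p)"
    by unfold_locales
  \<comment> \<open>Factors equal to 1 off J extend the product to all of I, where the product rule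
    for integrals applies.\<close>
  let ?f = "\<lambda>i x. if i \<in> J then of_bool x else 1 :: real"
  have int: "integrable (measure_pmf (bernoulli_pmf p)) (?f i)" for i
    by (rule measure_pmf.integrable_const_bound[of _ 1]) auto
  have eq: "(\<Prod>i\<in>I. ?f i (s i)) = (\<Prod>i\<in>J. of_bool (s i))" for s
    using assms by (simp add: prod.If_cases Int_absorb1)
  have "integrable (PiM I (\<lambda>_. measure_pmf (bernoulli_pmf p))) (\<lambda>s. \<Prod>i\<in>I. ?f i (s i))"
    using \<open>finite I\<close> int by (rule product_integrable_prod)
  moreover have "(\<integral>s. (\<Prod>i\<in>I. ?f i (s i)) \<partial>PiM I (\<lambda>_. measure_pmf (bernoulli_pmf p)))
      = (\<Prod>i\<in>I. if i \<in> J then p else 1)"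
    using assms by (subst product_integral_prod[OF \<open>finite I\<close> int]) (auto intro!: prod.cong)
  moreover have "\<dots> = p ^ card J"
    using assms by (simp add: prod.If_cases Int_absorb1)
  ultimately show ?thesis
    by (simp only: eq has_bochner_integral_iff)
qed

lemma has_bochner_integral_nonneg':
  fixes x :: real
  assumes "has_bochner_integral M f x" "\<And>\<omega>. 0 \<le> f \<omega>"
  shows "0 \<le> x"
  using assms by (auto simp: has_bochner_integral_iff)

text \<open>Unbiasedness comes from p n = b. In the second moment the double sum has weight p^2 off
  the diagonal and p on it, which gives at most (b^2 + b) \<tau>^2 / b^2; with b \<ge> 1 this is at
  most 2 \<tau>^2, the origin of the factor 2.\<close>

lemma minibatch_moments:
  fixes c :: "nat \<Rightarrow> 'a::euclidean_space" and b \<tau> :: real and n :: nat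
  defines "P \<equiv> PiM {..<n} (\<lambda>_. measure_pmf (bernoulli_pmf (b / real n)))"
    and "u \<equiv> \<lambda>s. (1 / b) *\<^sub>R (\<Sum>i\<in>{i. i < n \<and> s i}. c i)"
  assumes b: "1 \<le> b" "b \<le> real n" and c: "\<And>i. i < n \<Longrightarrow> norm (c i) \<le> \<tau>"
  shows "has_bochner_integral P (\<lambda>s. v \<bullet> u s) (v \<bullet> ((1 / real n) *\<^sub>R (\<Sum>i<n. c i)))"
    and "\<exists>m. has_bochner_integral P (\<lambda>s. (norm (u s))\<^sup>2) m \<and> m \<le> 2 * \<tau>\<^sup>2"
proof -
  define p where "p = b / real n"
  have n: "n > 0" using b by (cases n) auto
  have p: "0 \<le> p" "p \<le> 1" using b n by (auto simp: p_def)
  have pn: "p * real n = b" using n by (simp add: p_def)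
  have \<tau>: "\<tau> \<ge> 0" using c[of 0] n norm_ge_zero[of "c 0"] by linarith
  have u_eq: "u s = (1 / b) *\<^sub>R (\<Sum>i<n. of_bool (s i) *\<^sub>R c i)" for s
  proof -
    have "(\<Sum>i\<in>{i. i < n \<and> s i}. c i) = (\<Sum>i<n. of_bool (s i) *\<^sub>R c i)"
      by (rule sum.mono_neutral_cong_left) auto
    then show ?thesis by (simp add: u_def)
  qed
  have norm_sum_sq: "(norm (\<Sum>i<n. a i *\<^sub>R c i))\<^sup>2 = (\<Sum>i<n. \<Sum>j<n. a i * a j * (c i \<bullet> c j))" for a
    unfolding power2_norm_eq_inner inner_sum_left
    unfolding inner_sum_right by (simp add: mult_ac)
  have E: "has_bochner_integral P (\<lambda>s. \<Prod>i\<in>J. of_bool (s i)) (p ^ card J)"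
    if "J \<subseteq> {..<n}" for J
    using that p unfolding P_def p_def by (intro has_bochner_integral_PiM_bernoulli) auto
  have E1: "has_bochner_integral P (\<lambda>s. of_bool (s i)) p" if "i < n" for i
    using E[of "{i}"] that by simp
  \<comment> \<open>An indicator equals its square, so the diagonal value is p, written as p^2 plus
    a correction. The p^2 parts then add up to a full squared norm.\<close>
  have E2: "has_bochner_integral P (\<lambda>s. of_bool (s i) * of_bool (s j))
      (p\<^sup>2 + (if i = j then p - p\<^sup>2 else 0))" if "i < n" "j < n" for i j
  proof (cases "i = j")
    case True
    then show ?thesis using E1[of i] that by (simp flip: of_bool_conj)
  next
    case False
    then show ?thesis using E[of "{i, j}"] that by (simp add: power2_eq_square)
  qed
  have "has_bochner_integral P (\<lambda>s. (1 / b) * (\<Sum>i<n. of_bool (s i) * (v \<bullet> c i)))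
      ((1 / b) * (\<Sum>i<n. p * (v \<bullet> c i)))"
    by (intro has_bochner_integral_mult_right has_bochner_integral_sum has_bochner_integral_mult_left E1)
       auto
  moreover have "(1 / b) * (\<Sum>i<n. p * (v \<bullet> c i)) = v \<bullet> ((1 / real n) *\<^sub>R (\<Sum>i<n. c i))"
    using b n unfolding sum_distrib_left[symmetric] by (simp add: p_def inner_sum_right)
  ultimately show "has_bochner_integral P (\<lambda>s. v \<bullet> u s) (v \<bullet> ((1 / real n) *\<^sub>R (\<Sum>i<n. c i)))"
    by (simp add: u_eq inner_sum_right)
  define m where "m = (1 / b\<^sup>2) * (\<Sum>i<n. \<Sum>j<n. (p\<^sup>2 + (if i = j then p - p\<^sup>2 else 0)) * (c i \<bullet> c j))"
  have "has_bochner_integral P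
      (\<lambda>s. (1 / b\<^sup>2) * (\<Sum>i<n. \<Sum>j<n. of_bool (s i) * of_bool (s j) * (c i \<bullet> c j))) m"
    unfolding m_def
    by (intro has_bochner_integral_mult_right has_bochner_integral_sum has_bochner_integral_mult_left E2)
       auto
  moreover have "(norm (u s))\<^sup>2 =
      (1 / b\<^sup>2) * (\<Sum>i<n. \<Sum>j<n. of_bool (s i) * of_bool (s j) * (c i \<bullet> c j))" for s
    unfolding u_eq by (simp only: norm_scaleR power_mult_distrib norm_sum_sq) (simp add: power_divide)
  moreover have "m \<le> 2 * \<tau>\<^sup>2"
  proof -
    have "norm (\<Sum>i<n. c i) \<le> real n * \<tau>"
      using sum_norm_bound[of "{..<n}" c \<tau>] c by simp
    then have sum_sq: "(norm (\<Sum>i<n. c i))\<^sup>2 \<le> (real n)\<^sup>2 * \<tau>\<^sup>2"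
      using power_mono[of _ _ 2] by (fastforce simp: power_mult_distrib)
    have "c i \<bullet> c i \<le> \<tau>\<^sup>2" if "i < n" for i
      using power_mono[OF c[OF that], of 2] by (simp add: power2_norm_eq_inner)
    then have diag: "(\<Sum>i<n. c i \<bullet> c i) \<le> real n * \<tau>\<^sup>2"
      using sum_bounded_above[of "{..<n}" "\<lambda>i. c i \<bullet> c i" "\<tau>\<^sup>2"] by simp
    have "(\<Sum>i<n. \<Sum>j<n. (p\<^sup>2 + (if i = j then p - p\<^sup>2 else 0)) * (c i \<bullet> c j))
        = (\<Sum>i<n. \<Sum>j<n. p\<^sup>2 * (c i \<bullet> c j)) + (\<Sum>i<n. \<Sum>j<n. if i = j then (p - p\<^sup>2) * (c i \<bullet> c j) else 0)"
      by (subst sum.distrib[symmetric], intro sum.cong refl, subst sum.distrib[symmetric], intro sum.cong refl)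
         (auto simp: algebra_simps)
    also have "\<dots> = p\<^sup>2 * (norm (\<Sum>i<n. c i))\<^sup>2 + (p - p\<^sup>2) * (\<Sum>i<n. c i \<bullet> c i)"
      using norm_sum_sq[of "\<lambda>_. 1"] by (simp add: sum_distrib_left)
    also have "\<dots> \<le> p\<^sup>2 * ((real n)\<^sup>2 * \<tau>\<^sup>2) + p * (real n * \<tau>\<^sup>2)"
    proof (intro add_mono mult_left_mono sum_sq)
      \<comment> \<open>The sign of the diagonal weight is needed before the diagonal sum may be
        replaced by its upper bound.\<close>
      have "p - p\<^sup>2 \<ge> 0" using p by (simp add: power2_eq_square mult_left_le)
      then have "(p - p\<^sup>2) * (\<Sum>i<n. c i \<bullet> c i) \<le> (p - p\<^sup>2) * (real n * \<tau>\<^sup>2)"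
        using diag by (intro mult_left_mono)
      also have "\<dots> \<le> p * (real n * \<tau>\<^sup>2)"
        using p by (intro mult_right_mono) auto
      finally show "(p - p\<^sup>2) * (\<Sum>i<n. c i \<bullet> c i) \<le> p * (real n * \<tau>\<^sup>2)" .
    qed simp
    also have "\<dots> = b\<^sup>2 * \<tau>\<^sup>2 + b * \<tau>\<^sup>2"
      by (simp flip: pn add: power_mult_distrib mult.assoc)
    also have "\<dots> \<le> b\<^sup>2 * (2 * \<tau>\<^sup>2)"
    proof -
      have "b * \<tau>\<^sup>2 \<le> b\<^sup>2 * \<tau>\<^sup>2"
        using b by (intro mult_right_mono) (auto simp: power2_eq_square)
      then show ?thesis by linarith
    qed
    finally show ?thesis
      using b unfolding m_def by (simp add: divide_le_eq mult.commute)
  qed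
  ultimately show "\<exists>m. has_bochner_integral P (\<lambda>s. (norm (u s))\<^sup>2) m \<and> m \<le> 2 * \<tau>\<^sup>2"
    by auto
qed

section \<open>Expected descent in one noisy step\<close>

text \<open>With w fixed, \<open>c\<close> stands for the clipped gradients at w and
  \<open>gr\<close> for the true gradient. The smoothness bound dominates F by a quadratic
  polynomial in the noise and the minibatch mean, so the moments of these two suffice.\<close>

lemma noisy_step_descent:
  fixes F :: "'a::euclidean_space \<Rightarrow> real" and c :: "nat \<Rightarrow> 'a" and b \<tau> s2 :: real and n :: nat
  assumes F_nonneg: "\<And>w. F w \<ge> 0"
    and upper: "\<And>v. F (w + v) \<le> F w + gr \<bullet> v + L / 2 * (norm v)\<^sup>2"
    and b: "1 \<le> b" "b \<le> real n" and c: "\<And>i. i < n \<Longrightarrow> norm (c i) \<le> \<tau>"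
    and bias: "norm (gr - (1 / real n) *\<^sub>R (\<Sum>i<n. c i)) \<le> B"
    and "\<eta> > 0" "s2 > 0" "L \<ge> 0"
  shows "(\<integral>\<^sup>+ s. \<integral>\<^sup>+ z. ennreal (F (w - \<eta> *\<^sub>R ((1 / b) *\<^sub>R (\<Sum>i\<in>{i. i < n \<and> s i}. c i) + z)))
             \<partial>gauss_vec s2 \<partial>PiM {..<n} (\<lambda>_. measure_pmf (bernoulli_pmf (b / real n))))
           + ennreal (\<eta> / 2 * (norm gr)\<^sup>2)
         \<le> ennreal (F w) + ennreal (\<eta> / 2 * B\<^sup>2 + L * \<eta>\<^sup>2 / 2 * (2 * \<tau>\<^sup>2 + DIM('a) * s2))"
proof -
  let ?P = "PiM {..<n} (\<lambda>_. measure_pmf (bernoulli_pmf (b / real n)))"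
  define u where "u = (\<lambda>s. (1 / b) *\<^sub>R (\<Sum>i\<in>{i. i < n \<and> s i}. c i))"
  define a where "a = (1 / real n) *\<^sub>R (\<Sum>i<n. c i)"
  define d where "d = DIM('a) * s2"
  \<comment> \<open>This is the mean of the quadratic bound over the noise: the terms linear in z
    vanish and |z|^2 contributes \<open>d\<close>.\<close>
  define h where "h s = F w - \<eta> * (gr \<bullet> u s) + L * \<eta>\<^sup>2 / 2 * ((norm (u s))\<^sup>2 + d)" for s
  interpret G: prob_space "gauss_vec s2 :: 'a measure"
    using \<open>s2 > 0\<close> by (rule prob_space_gauss_vec)
  interpret P: prob_space ?P
    by (intro prob_space_PiM prob_space_measure_pmf)
  obtain m where m: "has_bochner_integral ?P (\<lambda>s. (norm (u s))\<^sup>2) m" "m \<le> 2 * \<tau>\<^sup>2"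
    using minibatch_moments(2)[OF b, of c] c unfolding u_def by blast
  have mean: "has_bochner_integral ?P (\<lambda>s. gr \<bullet> u s) (gr \<bullet> a)"
    unfolding u_def a_def by (rule minibatch_moments(1)[OF b, of c, OF c])
  have noise: "h s \<ge> 0"
    "(\<integral>\<^sup>+ z. ennreal (F (w - \<eta> *\<^sub>R (u s + z))) \<partial>gauss_vec s2) \<le> ennreal (h s)" for s
  proof -
    define q where "q z = F w - \<eta> * (gr \<bullet> u s) - \<eta> * (gr \<bullet> z)
        + L * \<eta>\<^sup>2 / 2 * ((norm (u s))\<^sup>2 + 2 * (u s \<bullet> z) + (norm z)\<^sup>2)" for z
    have F_le: "F (w - \<eta> *\<^sub>R (u s + z)) \<le> q z" for z
    proof -
      have "F (w - \<eta> *\<^sub>R (u s + z)) \<le> F w + gr \<bullet> (- \<eta> *\<^sub>R (u s + z)) + L / 2 * (norm (- \<eta> *\<^sub>R (u s + z)))\<^sup>2"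
        using upper[of "- \<eta> *\<^sub>R (u s + z)"] by simp
      also have "(norm (- \<eta> *\<^sub>R (u s + z)))\<^sup>2 = \<eta>\<^sup>2 * ((norm (u s))\<^sup>2 + 2 * (u s \<bullet> z) + (norm z)\<^sup>2)"
        by (simp add: power_mult_distrib power2_norm_eq_inner inner_add_left inner_add_right inner_commute)
      finally show ?thesis by (simp add: q_def algebra_simps inner_add_right)
    qed
    have int1: "has_bochner_integral (gauss_vec s2) (\<lambda>_::'a. x) x" for x :: real
      by (simp add: has_bochner_integral_iff G.prob_space[simplified])
    have "has_bochner_integral (gauss_vec s2) q
       (F w - \<eta> * (gr \<bullet> u s) - \<eta> * 0 + L * \<eta>\<^sup>2 / 2 * ((norm (u s))\<^sup>2 + 2 * 0 + d))"
      unfolding q_def d_def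
      by (intro has_bochner_integral_add has_bochner_integral_diff has_bochner_integral_mult_right
            int1 gauss_vec_moments \<open>s2 > 0\<close>)
    then have q: "has_bochner_integral (gauss_vec s2) q (h s)" by (simp add: h_def)
    \<comment> \<open>Nonnegativity, inherited from F, lets the nonnegative integral of the bound be
      read off from its Bochner integral.\<close>
    have q_nonneg: "q z \<ge> 0" for z using F_le[of z] F_nonneg by (meson order_trans)
    show "h s \<ge> 0"
      using q q_nonneg by (rule has_bochner_integral_nonneg')
    have "(\<integral>\<^sup>+ z. ennreal (F (w - \<eta> *\<^sub>R (u s + z))) \<partial>gauss_vec s2) \<le> (\<integral>\<^sup>+ z. ennreal (q z) \<partial>gauss_vec s2)"
      by (intro nn_integral_mono ennreal_leI F_le)
    also have "\<dots> = ennreal (h s)"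
      using q q_nonneg by (simp add: has_bochner_integral_iff nn_integral_eq_integral)
    finally show "(\<integral>\<^sup>+ z. ennreal (F (w - \<eta> *\<^sub>R (u s + z))) \<partial>gauss_vec s2) \<le> ennreal (h s)" .
  qed
  \<comment> \<open>Averaging \<open>h\<close> over the minibatch replaces u by its mean
    \<open>a\<close> and |u|^2 by \<open>m\<close>.\<close>
  define H where "H = F w - \<eta> * (gr \<bullet> a) + L * \<eta>\<^sup>2 / 2 * (m + d)"
  have int1: "has_bochner_integral ?P (\<lambda>_. x) x" for x :: real
    by (simp add: has_bochner_integral_iff P.prob_space)
  have h: "has_bochner_integral ?P h H"
    unfolding h_def H_def
    by (intro has_bochner_integral_add has_bochner_integral_diff has_bochner_integral_mult_right
          int1 mean m)
  then have H_nonneg: "H \<ge> 0"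
    using noise(1) by (rule has_bochner_integral_nonneg')
  have "(\<integral>\<^sup>+ s. \<integral>\<^sup>+ z. ennreal (F (w - \<eta> *\<^sub>R (u s + z))) \<partial>gauss_vec s2 \<partial>?P) \<le> (\<integral>\<^sup>+ s. ennreal (h s) \<partial>?P)"
    by (intro nn_integral_mono noise(2))
  also have "\<dots> = ennreal H"
    using h noise(1) by (simp add: has_bochner_integral_iff nn_integral_eq_integral)
  finally have "(\<integral>\<^sup>+ s. \<integral>\<^sup>+ z. ennreal (F (w - \<eta> *\<^sub>R (u s + z))) \<partial>gauss_vec s2 \<partial>?P)
        + ennreal (\<eta> / 2 * (norm gr)\<^sup>2) \<le> ennreal H + ennreal (\<eta> / 2 * (norm gr)\<^sup>2)"
    by (intro add_right_mono)
  also have "\<dots> = ennreal (H + \<eta> / 2 * (norm gr)\<^sup>2)"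
    using H_nonneg \<open>\<eta> > 0\<close> by (simp add: ennreal_plus)
  also have "\<dots> \<le> ennreal (F w + (\<eta> / 2 * B\<^sup>2 + L * \<eta>\<^sup>2 / 2 * (2 * \<tau>\<^sup>2 + d)))"
  proof (rule ennreal_leI)
    \<comment> \<open>\<open>2 gr \<bullet> a = |gr|\<^sup>2 + |a|\<^sup>2 - |gr - a|\<^sup>2\<close>\<close>
    have "(norm gr)\<^sup>2 - 2 * (gr \<bullet> a) \<le> (norm (gr - a))\<^sup>2"
      by (simp add: power2_norm_eq_inner inner_diff_left inner_diff_right inner_commute)
    also have "\<dots> \<le> B\<^sup>2"
      using bias by (simp add: a_def power_mono)
    finally have "\<eta> / 2 * ((norm gr)\<^sup>2 - 2 * (gr \<bullet> a)) \<le> \<eta> / 2 * B\<^sup>2"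
      using \<open>\<eta> > 0\<close> by (intro mult_left_mono) auto
    moreover have "L * \<eta>\<^sup>2 / 2 * (m + d) \<le> L * \<eta>\<^sup>2 / 2 * (2 * \<tau>\<^sup>2 + d)"
      using m(2) \<open>L \<ge> 0\<close> by (intro mult_left_mono) auto
    moreover have "\<eta> / 2 * ((norm gr)\<^sup>2 - 2 * (gr \<bullet> a)) = \<eta> / 2 * (norm gr)\<^sup>2 - \<eta> * (gr \<bullet> a)"
      by (simp add: right_diff_distrib)
    ultimately show "H + \<eta> / 2 * (norm gr)\<^sup>2 \<le> F w + (\<eta> / 2 * B\<^sup>2 + L * \<eta>\<^sup>2 / 2 * (2 * \<tau>\<^sup>2 + d))"
      unfolding H_def by linarith
  qed
  also have "\<dots> = ennreal (F w) + ennreal (\<eta> / 2 * B\<^sup>2 + L * \<eta>\<^sup>2 / 2 * (2 * \<tau>\<^sup>2 + d))"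
    using F_nonneg[of w] \<open>\<eta> > 0\<close> \<open>L \<ge> 0\<close> \<open>s2 > 0\<close> by (intro ennreal_plus) (auto simp: d_def)
  finally show ?thesis
    by (simp add: u_def d_def)
qed

section \<open>Measurability of the iterates and the potential along a run\<close>

text \<open>Points of a product space are extensional, so a coordinate outside I is constantly
  \<open>undefined\<close>. Measurability of the randomness can thus be claimed for all step and
  sample indices, without tracking ranges through the recursion.\<close>

lemma measurable_PiM_component_of_UNIV:
  assumes "\<And>i. i \<in> I \<Longrightarrow> f \<in> measurable (M i) N" and "f undefined \<in> space N"
  shows "(\<lambda>x. f (x i)) \<in> measurable (PiM I M) N"
proof (cases "i \<in> I")
  case True
  then show ?thesis using assms(1)[OF True] by measurable
next
  case False
  then have "(\<lambda>x. f (x i)) \<in> measurable (PiM I M) N \<longleftrightarrow> (\<lambda>_. f undefined) \<in> measurable (PiM I M) N"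
    by (intro measurable_cong) (auto simp: space_PiM PiE_def extensional_def)
  then show ?thesis using assms(2) by simp
qed

text \<open>The randomness is an arbitrary measurable function of \<omega>, so that the result also
  covers product spaces in other orders and inputs with one coordinate overwritten.\<close>

lemma borel_measurable_dpsgd_iter:
  fixes gl :: "'a::euclidean_space \<Rightarrow> 'z \<Rightarrow> 'a"
  assumes gl: "\<And>i. i < n \<Longrightarrow> (\<lambda>w. gl w (Z i)) \<in> borel_measurable borel"
    and S: "\<And>t i. i < n \<Longrightarrow> (\<lambda>\<omega>. S \<omega> t i) \<in> measurable M (count_space UNIV)"
    and \<zeta>: "\<And>t. (\<lambda>\<omega>. \<zeta> \<omega> t) \<in> borel_measurable M"
  shows "(\<lambda>\<omega>. dpsgd_iter gl Z n b \<tau> \<eta> w0 (S \<omega>) (\<zeta> \<omega>) t) \<in> borel_measurable M"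
proof (induction t)
  case (Suc t)
  note [measurable] = Suc.IH \<zeta>
  have [measurable]: "(\<lambda>\<omega>. if S \<omega> t i then clip (gl (dpsgd_iter gl Z n b \<tau> \<eta> w0 (S \<omega>) (\<zeta> \<omega>) t) (Z i)) \<tau> else 0)
      \<in> borel_measurable M" if "i \<in> {..<n}" for i
  proof -
    have [measurable]: "i < n" using that by simp
    note [measurable] = S[of i t] gl[of i]
    show ?thesis by measurable
  qed
  \<comment> \<open>A sum over a random index set becomes a sum over a fixed one, whose summands are
    measurable.\<close>
  have "(\<Sum>i\<in>{i. i < n \<and> s i}. f i) = (\<Sum>i<n. if s i then f i else 0)" for s and f :: "nat \<Rightarrow> 'a"
    by (rule sum.mono_neutral_cong_left) auto
  then show ?case
    by (simp add: Let_def)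
qed simp

text \<open>Causality: this permits integrating out the randomness of step t while iterates up to
  and including t are held fixed.\<close>

lemma dpsgd_iter_cong:
  assumes "\<And>s. s < t \<Longrightarrow> S s = S' s" "\<And>s. s < t \<Longrightarrow> \<zeta> s = \<zeta>' s"
  shows "dpsgd_iter gl Z n b \<tau> \<eta> w0 S \<zeta> t = dpsgd_iter gl Z n b \<tau> \<eta> w0 S' \<zeta>' t"
  using assms by (induction t) auto

text \<open>The potential is the current value of F plus the weighted squared gradients met so far.
  Given the past, its expectation grows by at most K per step, so potential minus t K behaves as a
  supermartingale. The induction enlarges the product spaces by one coordinate at a time.\<close>

lemma dpsgd_potential_bound:
  fixes F :: "'a::euclidean_space \<Rightarrow> real" and gl :: "'a \<Rightarrow> 'z \<Rightarrow> 'a" and gr :: "'a \<Rightarrow> 'a"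
    and b \<tau> \<eta> s2 L B :: real and n :: nat and Z :: "nat \<Rightarrow> 'z" and w0 :: 'a
  defines "P \<equiv> PiM {..<n} (\<lambda>_. measure_pmf (bernoulli_pmf (b / real n)))"
    and "K \<equiv> \<eta> / 2 * B\<^sup>2 + L * \<eta>\<^sup>2 / 2 * (2 * \<tau>\<^sup>2 + DIM('a) * s2)"
    and "iter \<equiv> dpsgd_iter gl Z n b \<tau> (\<lambda>_. \<eta>) w0"
  assumes F_nonneg: "\<And>w. F w \<ge> 0"
    and upper: "\<And>w v. F (w + v) \<le> F w + gr w \<bullet> v + L / 2 * (norm v)\<^sup>2"
    and [measurable]: "F \<in> borel_measurable borel" "gr \<in> borel_measurable borel"
    and gl: "\<And>i. i < n \<Longrightarrow> (\<lambda>w. gl w (Z i)) \<in> borel_measurable borel"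
    and bias: "\<And>w. norm (gr w - (1 / real n) *\<^sub>R (\<Sum>i<n. clip (gl w (Z i)) \<tau>)) \<le> B"
    and b: "1 \<le> b" "b \<le> real n" and pos: "\<eta> > 0" "s2 > 0" "L \<ge> 0" "\<tau> \<ge> 0"
  shows "(\<integral>\<^sup>+ S. \<integral>\<^sup>+ \<zeta>. ennreal (F (iter S \<zeta> t)) + (\<Sum>s<t. ennreal (\<eta> / 2 * (norm (gr (iter S \<zeta> s)))\<^sup>2))
            \<partial>PiM {..<t} (\<lambda>_. gauss_vec s2) \<partial>PiM {..<t} (\<lambda>_. P))
         \<le> ennreal (F w0) + of_nat t * ennreal K"
proof (induction t)
  case 0
  then show ?case
    by (simp add: PiM_empty nn_integral_count_space_finite iter_def)
next
  case (Suc t)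
  let ?G = "gauss_vec s2 :: 'a measure"
  let ?PP = "\<lambda>t. PiM {..<t::nat} (\<lambda>_. P)" and ?PG = "\<lambda>t. PiM {..<t::nat} (\<lambda>_. ?G)"
  interpret G: prob_space ?G
    using \<open>s2 > 0\<close> by (rule prob_space_gauss_vec)
  interpret P: prob_space P
    unfolding P_def by (intro prob_space_PiM prob_space_measure_pmf)
  interpret GG: product_sigma_finite "\<lambda>_. ?G"
    by unfold_locales
  interpret PP: product_sigma_finite "\<lambda>_. P"
    by unfold_locales
  interpret PGt: prob_space "?PG t"
    by (intro prob_space_PiM G.prob_space_axioms)
  interpret PGs: prob_space "?PG (Suc t)"
    by (intro prob_space_PiM G.prob_space_axioms)
  interpret PPt: prob_space "?PP t"
    by (intro prob_space_PiM P.prob_space_axioms)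
  have P_comp: "(\<lambda>x. x i) \<in> measurable P (count_space UNIV)" for i
    unfolding P_def by (intro measurable_PiM_component_of_UNIV) auto
  have G_comp: "(\<lambda>x. x i) \<in> borel_measurable (?PG m)" for i m
    by (intro measurable_PiM_component_of_UNIV[where f="\<lambda>x. x"]) auto
  have PP_comp: "(\<lambda>x. x k i) \<in> measurable (?PP m) (count_space UNIV)" for i k m
    by (intro measurable_PiM_component_of_UNIV[where f="\<lambda>x. x i"] P_comp) auto
  define \<Phi> where "\<Phi> t S \<zeta> = ennreal (F (iter S \<zeta> t)) + (\<Sum>s<t. ennreal (\<eta> / 2 * (norm (gr (iter S \<zeta> s)))\<^sup>2))"
    for t S \<zeta>
  have \<Phi>_meas: "(\<lambda>\<omega>. \<Phi> m (S \<omega>) (\<zeta> \<omega>)) \<in> borel_measurable M"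
    if "\<And>t i. i < n \<Longrightarrow> (\<lambda>\<omega>. S \<omega> t i) \<in> measurable M (count_space UNIV)"
      "\<And>t. (\<lambda>\<omega>. \<zeta> \<omega> t) \<in> borel_measurable M" for m M and S \<zeta>
  proof -
    have [measurable]: "(\<lambda>\<omega>. iter (S \<omega>) (\<zeta> \<omega>) t) \<in> borel_measurable M" for t
      unfolding iter_def by (intro borel_measurable_dpsgd_iter gl that)
    show ?thesis unfolding \<Phi>_def by measurable
  qed
  have \<Phi>_pair: "(\<lambda>(S, \<zeta>). \<Phi> (Suc t) S \<zeta>) \<in> borel_measurable (?PP (Suc t) \<Otimes>\<^sub>M ?PG (Suc t))"
    unfolding split_beta
    by (intro \<Phi>_meas measurable_compose[OF measurable_fst PP_comp] measurable_compose[OF measurable_snd G_comp])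
  \<comment> \<open>This is the conditional expectation over step t alone, with all earlier
    randomness fixed in \<open>S\<close> and \<open>\<zeta>\<close>.\<close>
  have step: "(\<integral>\<^sup>+ s. \<integral>\<^sup>+ z. \<Phi> (Suc t) (S(t := s)) (\<zeta>(t := z)) \<partial>?G \<partial>P) \<le> \<Phi> t S \<zeta> + ennreal K" for S \<zeta>
  proof -
    \<comment> \<open>The case r = t is included: iterate t uses only the randomness of steps before
      t.\<close>
    have old: "iter (S(t := s)) (\<zeta>(t := z)) r = iter S \<zeta> r" if "r \<le> t" for r s z
      using that unfolding iter_def by (intro dpsgd_iter_cong) auto
    let ?w = "iter S \<zeta> t"
    let ?R = "\<Sum>s<t. ennreal (\<eta> / 2 * (norm (gr (iter S \<zeta> s)))\<^sup>2)"
    let ?new = "\<lambda>s z. ?w - \<eta> *\<^sub>R ((1 / b) *\<^sub>R (\<Sum>i\<in>{i. i < n \<and> s i}. clip (gl ?w (Z i)) \<tau>) + z)"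
    have "iter (S(t := s)) (\<zeta>(t := z)) (Suc t) = ?new s z" for s z
      using old[of t] by (simp add: iter_def Let_def)
    then have eq: "\<Phi> (Suc t) (S(t := s)) (\<zeta>(t := z)) =
        ennreal (F (?new s z)) + (?R + ennreal (\<eta> / 2 * (norm (gr ?w))\<^sup>2))" for s z
      by (simp add: \<Phi>_def old del: fun_upd_apply)
    have [measurable]: "(\<lambda>(s, z). ennreal (F (?new s z))) \<in> borel_measurable (P \<Otimes>\<^sub>M ?G)"
    proof -
      have "(\<lambda>(s, z). F (iter (S(t := s)) (\<zeta>(t := z)) (Suc t))) \<in> borel_measurable (P \<Otimes>\<^sub>M ?G)"
        unfolding split_beta iter_def
      proof (intro measurable_compose[OF borel_measurable_dpsgd_iter \<open>F \<in> _\<close>] gl)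
        show "(\<lambda>\<omega>. (S(t := fst \<omega>)) r i) \<in> measurable (P \<Otimes>\<^sub>M ?G) (count_space UNIV)" for r i
          by (cases "r = t") (auto intro: measurable_compose[OF measurable_fst P_comp])
        show "(\<lambda>\<omega>. (\<zeta>(t := snd \<omega>)) r) \<in> borel_measurable (P \<Otimes>\<^sub>M ?G)" for r
          by (cases "r = t") auto
      qed
      then show ?thesis
        by (simp add: \<open>\<And>s z. iter (S(t := s)) (\<zeta>(t := z)) (Suc t) = ?new s z\<close>)
    qed
    have "(\<integral>\<^sup>+ s. \<integral>\<^sup>+ z. \<Phi> (Suc t) (S(t := s)) (\<zeta>(t := z)) \<partial>?G \<partial>P)
        = (\<integral>\<^sup>+ s. \<integral>\<^sup>+ z. ennreal (F (?new s z)) \<partial>?G \<partial>P) + (?R + ennreal (\<eta> / 2 * (norm (gr ?w))\<^sup>2))"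
      unfolding eq
      by (simp add: nn_integral_add G.emeasure_space_1[simplified] P.emeasure_space_1)
    also have "\<dots> = ((\<integral>\<^sup>+ s. \<integral>\<^sup>+ z. ennreal (F (?new s z)) \<partial>?G \<partial>P) + ennreal (\<eta> / 2 * (norm (gr ?w))\<^sup>2)) + ?R"
      by (simp add: ac_simps)
    also have "\<dots> \<le> (ennreal (F ?w) + ennreal K) + ?R"
      unfolding P_def K_def
      by (intro add_right_mono noisy_step_descent F_nonneg upper b bias norm_clip_le pos)
    finally show ?thesis
      by (simp add: \<Phi>_def ac_simps)
  qed
  have "(\<integral>\<^sup>+ S. \<integral>\<^sup>+ \<zeta>. \<Phi> (Suc t) S \<zeta> \<partial>?PG (Suc t) \<partial>?PP (Suc t))
      = (\<integral>\<^sup>+ S. \<integral>\<^sup>+ s. \<integral>\<^sup>+ \<zeta>. \<Phi> (Suc t) (S(t := s)) \<zeta> \<partial>?PG (Suc t) \<partial>P \<partial>?PP t)"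
    using PP.product_nn_integral_insert[of "{..<t}" t "\<lambda>S. \<integral>\<^sup>+ \<zeta>. \<Phi> (Suc t) S \<zeta> \<partial>?PG (Suc t)"]
      PGs.borel_measurable_nn_integral[OF \<Phi>_pair]
    by (simp add: lessThan_Suc)
  also have "\<dots> = (\<integral>\<^sup>+ S. \<integral>\<^sup>+ s. \<integral>\<^sup>+ \<zeta>. \<integral>\<^sup>+ z. \<Phi> (Suc t) (S(t := s)) (\<zeta>(t := z)) \<partial>?G \<partial>?PG t \<partial>P \<partial>?PP t)"
  proof (intro nn_integral_cong)
    fix S s
    have "\<Phi> (Suc t) (S(t := s)) \<in> borel_measurable (?PG (Suc t))"
      by (intro \<Phi>_meas G_comp) simp
    then show "(\<integral>\<^sup>+ \<zeta>. \<Phi> (Suc t) (S(t := s)) \<zeta> \<partial>?PG (Suc t))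
        = (\<integral>\<^sup>+ \<zeta>. \<integral>\<^sup>+ z. \<Phi> (Suc t) (S(t := s)) (\<zeta>(t := z)) \<partial>?G \<partial>?PG t)"
      using GG.product_nn_integral_insert[of "{..<t}" t "\<Phi> (Suc t) (S(t := s))"]
      by (simp add: lessThan_Suc)
  qed
  \<comment> \<open>Splitting off the last coordinates leaves the new minibatch outside the earlier
    noise. Fubini moves it inside, next to the new noise, where \<open>step\<close> applies.\<close>
  also have "\<dots> = (\<integral>\<^sup>+ S. \<integral>\<^sup>+ \<zeta>. \<integral>\<^sup>+ s. \<integral>\<^sup>+ z. \<Phi> (Suc t) (S(t := s)) (\<zeta>(t := z)) \<partial>?G \<partial>P \<partial>?PG t \<partial>?PP t)"
  proof (intro nn_integral_cong)
    fix S
    interpret pair_sigma_finite "?PG t" P ..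
    have "(\<lambda>\<omega>. \<Phi> (Suc t) (S(t := snd (fst \<omega>))) ((fst (fst \<omega>))(t := snd \<omega>)))
        \<in> borel_measurable ((?PG t \<Otimes>\<^sub>M P) \<Otimes>\<^sub>M ?G)"
    proof (intro \<Phi>_meas)
      show "(\<lambda>\<omega>. (S(t := snd (fst \<omega>))) r i)
          \<in> measurable ((?PG t \<Otimes>\<^sub>M P) \<Otimes>\<^sub>M ?G) (count_space UNIV)" for r i
        by (cases "r = t")
           (auto intro: measurable_compose[OF _ P_comp] measurable_compose[OF measurable_fst])
      show "(\<lambda>\<omega>. ((fst (fst \<omega>))(t := snd \<omega>)) r) \<in> borel_measurable ((?PG t \<Otimes>\<^sub>M P) \<Otimes>\<^sub>M ?G)" for r
        by (cases "r = t")
           (auto intro: measurable_compose[OF _ G_comp] measurable_compose[OF measurable_fst])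
    qed
    then have "(\<lambda>\<omega>. \<integral>\<^sup>+ z. \<Phi> (Suc t) (S(t := snd \<omega>)) ((fst \<omega>)(t := z)) \<partial>?G) \<in> borel_measurable (?PG t \<Otimes>\<^sub>M P)"
      by (intro G.borel_measurable_nn_integral) (simp add: split_beta)
    then show "(\<integral>\<^sup>+ s. \<integral>\<^sup>+ \<zeta>. \<integral>\<^sup>+ z. \<Phi> (Suc t) (S(t := s)) (\<zeta>(t := z)) \<partial>?G \<partial>?PG t \<partial>P)
        = (\<integral>\<^sup>+ \<zeta>. \<integral>\<^sup>+ s. \<integral>\<^sup>+ z. \<Phi> (Suc t) (S(t := s)) (\<zeta>(t := z)) \<partial>?G \<partial>P \<partial>?PG t)"
      by (intro Fubini') (simp add: split_beta)
  qed
  also have "\<dots> \<le> (\<integral>\<^sup>+ S. \<integral>\<^sup>+ \<zeta>. \<Phi> t S \<zeta> + ennreal K \<partial>?PG t \<partial>?PP t)"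
    by (intro nn_integral_mono step)
  also have "\<dots> = (\<integral>\<^sup>+ S. (\<integral>\<^sup>+ \<zeta>. \<Phi> t S \<zeta> \<partial>?PG t) + ennreal K \<partial>?PP t)"
  proof (intro nn_integral_cong)
    fix S
    have "\<Phi> t S \<in> borel_measurable (?PG t)"
      by (intro \<Phi>_meas G_comp) simp
    then show "(\<integral>\<^sup>+ \<zeta>. \<Phi> t S \<zeta> + ennreal K \<partial>?PG t) = (\<integral>\<^sup>+ \<zeta>. \<Phi> t S \<zeta> \<partial>?PG t) + ennreal K"
      by (simp add: nn_integral_add PGt.emeasure_space_1)
  qed
  also have "\<dots> = (\<integral>\<^sup>+ S. \<integral>\<^sup>+ \<zeta>. \<Phi> t S \<zeta> \<partial>?PG t \<partial>?PP t) + ennreal K"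
  proof -
    have "(\<lambda>(S, \<zeta>). \<Phi> t S \<zeta>) \<in> borel_measurable (?PP t \<Otimes>\<^sub>M ?PG t)"
      unfolding split_beta
      by (intro \<Phi>_meas measurable_compose[OF measurable_fst PP_comp] measurable_compose[OF measurable_snd G_comp])
    then have "(\<lambda>S. \<integral>\<^sup>+ \<zeta>. \<Phi> t S \<zeta> \<partial>?PG t) \<in> borel_measurable (?PP t)"
      by (rule PGt.borel_measurable_nn_integral)
    then show ?thesis
      by (simp add: nn_integral_add PPt.emeasure_space_1)
  qed
  also have "\<dots> \<le> (ennreal (F w0) + of_nat t * ennreal K) + ennreal K"
    using Suc.IH by (intro add_right_mono) (simp add: \<Phi>_def)
  also have "\<dots> = ennreal (F w0) + of_nat (Suc t) * ennreal K"
    by (simp add: algebra_simps)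
  finally show ?case
    by (simp add: \<Phi>_def)
qed

text \<open>The uniform output index makes the risk an average of squared gradients over the run,
  which the potential controls after multiplication by 2 / (T \<eta>). The parameters are still free
  here.\<close>

lemma dpsgd_OR_le:
  fixes gl :: "'a::euclidean_space \<Rightarrow> 'z \<Rightarrow> 'a" and b \<tau> \<eta> s2 L B :: real and n T :: nat
    and Z :: "nat \<Rightarrow> 'z"
  assumes F_nonneg: "\<And>w. F w \<ge> 0"
    and deriv: "\<And>w. (F has_derivative (\<lambda>h. emp_grad gl Z n w \<bullet> h)) (at w)"
    and lip: "\<And>w w'. norm (emp_grad gl Z n w - emp_grad gl Z n w') \<le> L * norm (w - w')"
    and gl: "\<And>i. i < n \<Longrightarrow> (\<lambda>w. gl w (Z i)) \<in> borel_measurable borel"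
    and bias: "\<And>w. norm (emp_grad gl Z n w - (1 / real n) *\<^sub>R (\<Sum>i<n. clip (gl w (Z i)) \<tau>)) \<le> B"
    and b: "1 \<le> b" "b \<le> real n" and pos: "\<eta> > 0" "s2 > 0" "L \<ge> 0" "\<tau> \<ge> 0" and "T \<ge> 1"
  shows "dpsgd_OR gl Z n b \<tau> (\<lambda>_. \<eta>) s2 w0 T
    \<le> ennreal (2 * F w0 / (real T * \<eta>) + B\<^sup>2 + L * \<eta> * (2 * \<tau>\<^sup>2 + DIM('a) * s2))"
proof -
  let ?P = "PiM {..<n} (\<lambda>_. measure_pmf (bernoulli_pmf (b / real n)))"
  let ?G = "gauss_vec s2 :: 'a measure"
  let ?PP = "PiM {..<T} (\<lambda>_. ?P)" and ?PG = "PiM {..<T} (\<lambda>_. ?G)"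
  let ?U = "measure_pmf (pmf_of_set {..<T})"
  let ?iter = "dpsgd_iter gl Z n b \<tau> (\<lambda>_. \<eta>) w0"
  let ?gr = "emp_grad gl Z n"
  define K where "K = \<eta> / 2 * B\<^sup>2 + L * \<eta>\<^sup>2 / 2 * (2 * \<tau>\<^sup>2 + DIM('a) * s2)"
  have K: "K \<ge> 0" using \<open>\<eta> > 0\<close> \<open>L \<ge> 0\<close> \<open>s2 > 0\<close> by (simp add: K_def)
  interpret PG: prob_space ?PG
    by (intro prob_space_PiM prob_space_gauss_vec \<open>s2 > 0\<close>)
  interpret PP: prob_space ?PP
    by (intro prob_space_PiM prob_space_measure_pmf)
  have F_meas: "F \<in> borel_measurable borel"
    by (intro borel_measurable_continuous_onI)
       (meson continuous_at_imp_continuous_on deriv has_derivative_continuous)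
  have gr_meas [measurable]: "?gr \<in> borel_measurable borel"
    unfolding emp_grad_def using gl
    by (intro borel_measurable_scaleR borel_measurable_sum) auto
  have P_comp: "(\<lambda>x. x i) \<in> measurable ?P (count_space UNIV)" for i
    by (intro measurable_PiM_component_of_UNIV) auto
  have G_comp: "(\<lambda>x. x i) \<in> borel_measurable ?PG" for i
    by (intro measurable_PiM_component_of_UNIV[where f="\<lambda>x. x"]) auto
  have PP_comp: "(\<lambda>x. x k i) \<in> measurable ?PP (count_space UNIV)" for i k
    by (intro measurable_PiM_component_of_UNIV[where f="\<lambda>x. x i"] P_comp) auto
  have iter_meas: "(\<lambda>\<omega>. ?iter (fst \<omega>) (snd \<omega>) t) \<in> borel_measurable (?PP \<Otimes>\<^sub>M ?PG)" for t
    by (intro borel_measurable_dpsgd_iter gl measurable_compose[OF measurable_fst PP_comp]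
          measurable_compose[OF measurable_snd G_comp])
  have g_meas [measurable]: "(\<lambda>\<omega>. ennreal ((norm (?gr (?iter (fst \<omega>) (snd \<omega>) t)))\<^sup>2)) \<in> borel_measurable (?PP \<Otimes>\<^sub>M ?PG)" for t
    using iter_meas[of t] by measurable
  have potential_meas: "(\<lambda>\<omega>. ennreal (F (?iter (fst \<omega>) (snd \<omega>) T))
        + (\<Sum>t<T. ennreal (\<eta> / 2 * (norm (?gr (?iter (fst \<omega>) (snd \<omega>) t)))\<^sup>2)))
      \<in> borel_measurable (?PP \<Otimes>\<^sub>M ?PG)"
  proof -
    have "(\<lambda>w. ennreal (F w)) \<in> borel_measurable borel"
      "(\<lambda>w. ennreal (\<eta> / 2 * (norm (?gr w))\<^sup>2)) \<in> borel_measurable borel"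
      using F_meas by measurable
    then show ?thesis
      by (intro borel_measurable_add borel_measurable_sum measurable_compose[OF iter_meas])
  qed
  \<comment> \<open>The output index ranges over a countable type, so joint measurability reduces to
    each fixed index.\<close>
  have all_meas: "(\<lambda>\<omega>. ennreal ((norm (?gr (?iter (fst (fst \<omega>)) (snd (fst \<omega>)) (snd \<omega>))))\<^sup>2))
      \<in> borel_measurable ((?PP \<Otimes>\<^sub>M ?PG) \<Otimes>\<^sub>M ?U)"
  proof (rule measurable_compose_countable
      [where f="\<lambda>t \<omega>. ennreal ((norm (?gr (?iter (fst (fst \<omega>)) (snd (fst \<omega>)) t)))\<^sup>2)" and g=snd])
    show "(\<lambda>\<omega>. ennreal ((norm (?gr (?iter (fst (fst \<omega>)) (snd (fst \<omega>)) t)))\<^sup>2))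
        \<in> borel_measurable ((?PP \<Otimes>\<^sub>M ?PG) \<Otimes>\<^sub>M ?U)" for t
      by (rule measurable_compose[OF measurable_fst g_meas])
  qed simp
  have "dpsgd_OR gl Z n b \<tau> (\<lambda>_. \<eta>) s2 w0 T
      = (\<integral>\<^sup>+ \<omega>. \<integral>\<^sup>+ t. ennreal ((norm (?gr (?iter (fst \<omega>) (snd \<omega>) t)))\<^sup>2) \<partial>?U \<partial>(?PP \<Otimes>\<^sub>M ?PG))"
    unfolding dpsgd_OR_def dpsgd_rand_def by (subst measure_pmf.nn_integral_fst[OF all_meas, symmetric]) simp
  also have "\<dots> = (\<integral>\<^sup>+ \<omega>. (\<Sum>t<T. ennreal ((norm (?gr (?iter (fst \<omega>) (snd \<omega>) t)))\<^sup>2)) / of_nat T \<partial>(?PP \<Otimes>\<^sub>M ?PG))"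
    using \<open>T \<ge> 1\<close> by (subst nn_integral_pmf_of_set) (auto simp: lessThan_empty_iff)
  \<comment> \<open>The value of F at the last iterate is added to complete the integrand to the
    potential; the prefactor turns the weights \<eta> / 2 into 1 / T.\<close>
  also have "\<dots> \<le> (\<integral>\<^sup>+ \<omega>. ennreal (2 / (real T * \<eta>)) * (ennreal (F (?iter (fst \<omega>) (snd \<omega>) T))
        + (\<Sum>t<T. ennreal (\<eta> / 2 * (norm (?gr (?iter (fst \<omega>) (snd \<omega>) t)))\<^sup>2))) \<partial>(?PP \<Otimes>\<^sub>M ?PG))"
  proof (intro nn_integral_mono)
    fix \<omega>
    let ?N = "\<lambda>t. (norm (?gr (?iter (fst \<omega>) (snd \<omega>) t)))\<^sup>2"
    have "(\<Sum>t<T. ennreal (?N t)) / of_nat T = ennreal ((\<Sum>t<T. ?N t) / real T)"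
      using \<open>T \<ge> 1\<close> by (simp add: sum_nonneg divide_ennreal ennreal_of_nat_eq_real_of_nat)
    also have "\<dots> = ennreal (2 / (real T * \<eta>) * (\<Sum>t<T. \<eta> / 2 * ?N t))"
      using \<open>\<eta> > 0\<close> unfolding sum_distrib_left[symmetric] by simp
    also have "\<dots> = ennreal (2 / (real T * \<eta>)) * (\<Sum>t<T. ennreal (\<eta> / 2 * ?N t))"
      using \<open>\<eta> > 0\<close> by (subst ennreal_mult) (auto simp: sum_nonneg)
    also have "\<dots> \<le> ennreal (2 / (real T * \<eta>)) * (ennreal (F (?iter (fst \<omega>) (snd \<omega>) T)) + (\<Sum>t<T. ennreal (\<eta> / 2 * ?N t)))"
      by (intro mult_left_mono) auto
    finally show "(\<Sum>t<T. ennreal (?N t)) / of_nat T \<le> \<dots>" .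
  qed
  also have "\<dots> = ennreal (2 / (real T * \<eta>)) * (\<integral>\<^sup>+ \<omega>. ennreal (F (?iter (fst \<omega>) (snd \<omega>) T))
        + (\<Sum>t<T. ennreal (\<eta> / 2 * (norm (?gr (?iter (fst \<omega>) (snd \<omega>) t)))\<^sup>2)) \<partial>(?PP \<Otimes>\<^sub>M ?PG))"
    by (rule nn_integral_cmult[OF potential_meas])
  also have "(\<integral>\<^sup>+ \<omega>. ennreal (F (?iter (fst \<omega>) (snd \<omega>) T))
        + (\<Sum>t<T. ennreal (\<eta> / 2 * (norm (?gr (?iter (fst \<omega>) (snd \<omega>) t)))\<^sup>2)) \<partial>(?PP \<Otimes>\<^sub>M ?PG))
     = (\<integral>\<^sup>+ S. \<integral>\<^sup>+ \<zeta>. ennreal (F (?iter S \<zeta> T)) + (\<Sum>t<T. ennreal (\<eta> / 2 * (norm (?gr (?iter S \<zeta> t)))\<^sup>2)) \<partial>?PG \<partial>?PP)"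
    by (subst PG.nn_integral_fst[OF potential_meas, symmetric]) simp
  also have "\<dots> \<le> ennreal (F w0) + of_nat T * ennreal K"
    unfolding K_def
    by (intro dpsgd_potential_bound F_nonneg smooth_upper_bound deriv lip F_meas gr_meas gl bias b pos)
  also have "\<dots> = ennreal (F w0 + real T * K)"
    using F_nonneg[of w0] K by (simp add: ennreal_of_nat_eq_real_of_nat ennreal_mult ennreal_plus)
  also have "ennreal (2 / (real T * \<eta>)) * \<dots> = ennreal (2 / (real T * \<eta>) * (F w0 + real T * K))"
    using F_nonneg[of w0] K \<open>\<eta> > 0\<close> by (subst ennreal_mult) auto
  also have "2 / (real T * \<eta>) * (F w0 + real T * K)
      = 2 * F w0 / (real T * \<eta>) + B\<^sup>2 + L * \<eta> * (2 * \<tau>\<^sup>2 + DIM('a) * s2)"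
    using \<open>\<eta> > 0\<close> \<open>T \<ge> 1\<close> by (simp add: K_def field_simps power2_eq_square)
  finally show ?thesis
    by (simp add: mult_left_mono)
qed

section \<open>The good event over the dataset\<close>

text \<open>Markov's inequality controls the empirical mean, and an almost sure property of one
  sample is turned into one that holds at every point of the event. The latter costs no probability,
  as only finitely many null sets are removed.\<close>

lemma empirical_mean_event:
  fixes h :: "'z \<Rightarrow> real" and n :: nat
  assumes "prob_space D" and int: "integrable D h" and nonneg: "\<And>z. h z \<ge> 0"
    and mean: "(\<integral>z. h z \<partial>D) \<le> m" and "m > 0" "\<gamma> > 0" "n \<ge> 1" and Q: "AE z in D. Q z"
  shows "\<exists>A \<in> sets (PiM {..<n} (\<lambda>_. D)). measure (PiM {..<n} (\<lambda>_. D)) A \<ge> 1 - \<gamma> \<and>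
    (\<forall>Z\<in>A. \<forall>i<n. Z i \<in> space D \<and> Q (Z i)) \<and>
    (\<forall>Z\<in>A. (1 / real n) * (\<Sum>i<n. h (Z i)) \<le> m / \<gamma>)"
proof -
  let ?M = "PiM {..<n} (\<lambda>_. D)"
  interpret D: prob_space D by fact
  interpret M: prob_space ?M by (intro prob_space_PiM D.prob_space_axioms)
  \<comment> \<open>The failure set of \<open>Q\<close> may be non-measurable (\<open>Q\<close> will
    quantify over all w), so a measurable null set covering it is used.\<close>
  obtain N where N: "{z \<in> space D. \<not> Q z} \<subseteq> N" "emeasure D N = 0" and [measurable]: "N \<in> sets D"
    using Q by (rule AE_E)
  define Y where "Y Z = (1 / real n) * (\<Sum>i<n. h (Z i))" for Z
  have "has_bochner_integral ?M (\<lambda>Z. h (Z i)) (\<integral>z. h z \<partial>D)" if "i < n" for i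
    using has_bochner_integral_PiM_component[of "{..<n}" "\<lambda>_. D" i h "\<integral>z. h z \<partial>D"] int that D.prob_space_axioms
    by (simp add: has_bochner_integral_iff)
  then have "has_bochner_integral ?M Y ((1 / real n) * (\<Sum>i<n. (\<integral>z. h z \<partial>D)))"
    unfolding Y_def by (intro has_bochner_integral_mult_right has_bochner_integral_sum) auto
  then have Y: "integrable ?M Y" "(\<integral>Z. Y Z \<partial>?M) \<le> m"
    using mean \<open>n \<ge> 1\<close> by (auto simp: has_bochner_integral_iff)
  have [measurable]: "Y \<in> borel_measurable ?M" using Y(1) by simp
  have Y_nonneg: "0 \<le> Y Z" for Z
    unfolding Y_def using nonneg by (intro mult_nonneg_nonneg sum_nonneg) auto
  \<comment> \<open>The strict inequality makes this, up to a null set, the complement of the event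
    in Markov's inequality.\<close>
  define A where "A = {Z \<in> space ?M. (\<forall>i\<in>{..<n}. Z i \<notin> N) \<and> Y Z < m / \<gamma>}"
  have A: "A \<in> sets ?M" unfolding A_def by measurable
  have "AE z in D. z \<notin> N"
    using N(2) by (intro AE_not_in) (simp add: null_sets_def)
  then have "AE Z in ?M. \<forall>i\<in>{..<n}. Z i \<notin> N"
    by (intro AE_finite_allI AE_PiM_component D.prob_space_axioms) auto
  then have "measure ?M A = measure ?M {Z \<in> space ?M. \<not> m / \<gamma> \<le> Y Z}"
    using A by (intro M.finite_measure_eq_AE) (auto simp: A_def)
  also have "\<dots> = 1 - measure ?M {Z \<in> space ?M. m / \<gamma> \<le> Y Z}"
    by (intro M.prob_neg) measurable
  also have "\<dots> \<ge> 1 - \<gamma>"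
  proof -
    have "measure ?M {Z \<in> space ?M. m / \<gamma> \<le> Y Z} \<le> (\<integral>Z. Y Z \<partial>?M) / (m / \<gamma>)"
      using Y(1) Y_nonneg \<open>m > 0\<close> \<open>\<gamma> > 0\<close>
      by (intro integral_Markov_inequality_measure[where A="{}"]) auto
    also have "\<dots> \<le> m / (m / \<gamma>)"
      using Y(2) \<open>m > 0\<close> \<open>\<gamma> > 0\<close> by (intro divide_right_mono) auto
    finally show ?thesis using \<open>m > 0\<close> by simp
  qed
  finally have "measure ?M A \<ge> 1 - \<gamma>" .
  moreover have "\<forall>Z\<in>A. \<forall>i<n. Z i \<in> space D \<and> Q (Z i)"
    using N(1) by (auto simp: A_def space_PiM PiE_def Pi_def)
  moreover have "\<forall>Z\<in>A. Y Z \<le> m / \<gamma>"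
    by (auto simp: A_def)
  ultimately show ?thesis
    using A unfolding Y_def by blast
qed

section \<open>Choice of the clip norm and the final rate\<close>

text \<open>The second identity is the equation that determines \<tau>: it amounts to \<tau>^(2k-1)
  = G^(2k) / (\<gamma>^2 C s \<psi>^(1/2)). Here s stands for sqrt L and \<psi> for 1/T + \<phi>^2.
  All quantities are positive, so logarithms reduce both identities to linear ones.\<close>

lemma tuned_clip_norm_identities:
  fixes G \<gamma> C s \<psi> k :: real
  defines "\<tau> \<equiv> G * (G / (\<gamma>\<^sup>2 * C * s)) powr (1 / (2 * k - 1)) * \<psi> powr (- (1 / (2 * (2 * k - 1))))"
  assumes pos: "G > 0" "\<gamma> > 0" "C > 0" "s > 0" "\<psi> > 0" and k: "k > 1"
  shows "\<tau> * s * \<psi> powr (1 / 2) = s powr (1 - 1 / (2 * k - 1)) * G powr (1 + 1 / (2 * k - 1))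
           / (\<gamma> powr (2 / (2 * k - 1)) * C powr (1 / (2 * k - 1))) * \<psi> powr (1 / 2 * (1 - 1 / (2 * k - 1)))"
      (is "?l1 = ?r1")
    and "(G powr k / (\<gamma> * \<tau> powr (k - 1)))\<^sup>2 = \<tau> * C * s * \<psi> powr (1 / 2)" (is "?l2 = ?r2")
proof -
  have \<tau>: "\<tau> > 0" unfolding \<tau>_def using pos by simp
  have \<tau>_ln: "ln \<tau> = ln G + (ln G - 2 * ln \<gamma> - ln C - ln s) / (2 * k - 1) - ln \<psi> / (2 * (2 * k - 1))"
    unfolding \<tau>_def using pos by (simp add: ln_mult ln_div ln_powr ln_realpow)
  have k': "2 * k - 1 \<noteq> 0" using k by simp
  have "ln ?l1 = ln ?r1"
    using pos \<tau> k' by (simp add: ln_mult ln_div ln_powr \<tau>_ln) (simp add: divide_simps, simp add: algebra_simps)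
  then show "?l1 = ?r1" using pos \<tau> by (subst (asm) ln_inj_iff) auto
  have "ln ?l2 = ln ?r2"
    using pos \<tau> k' by (simp add: ln_mult ln_div ln_powr ln_realpow \<tau>_ln) (simp add: divide_simps, simp add: algebra_simps)
  then show "?l2 = ?r2" using pos \<tau> by (subst (asm) ln_inj_iff) auto
qed

text \<open>The event is built from the gradient envelope alone; smoothness and attainment concern
  the drawn dataset and therefore enter as premises at each point of it.\<close>

theorem mainTheorem7:
  fixes D :: "'z measure"
    and loss :: "'a::euclidean_space \<Rightarrow> 'z \<Rightarrow> real"
    and gl :: "'a \<Rightarrow> 'z \<Rightarrow> 'a"
    and Gf :: "'z \<Rightarrow> real"
    and k G L \<gamma> C b \<epsilon> \<delta> \<nu> :: real
    and n T :: nat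
    and w0 :: 'a
  assumes D_prob: "prob_space D"
    and deriv: "\<And>z w. z \<in> space D \<Longrightarrow> ((\<lambda>w. loss w z) has_derivative (\<lambda>h. gl w z \<bullet> h)) (at w)"
    and Gf_nonneg: "\<And>z. Gf z \<ge> 0"
    and grad_bound: "AE z in D. \<forall>w. norm (gl w z) \<le> Gf z"
    and Gf_meas: "Gf \<in> borel_measurable D"
    and Gf_int: "integrable D (\<lambda>z. Gf z powr k)"
    and k_gt: "k > 1" and G_pos: "G > 0"
    and moment: "(\<integral>z. Gf z powr k \<partial>D) powr (1 / k) \<le> G"
    and L_pos: "L > 0"
    and \<gamma>: "0 < \<gamma>" "\<gamma> < 1" and C_pos: "C > 0" and T_ge: "T \<ge> 1"
    and n_ge: "n \<ge> 1" and b: "1 \<le> b" "b \<le> real n"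
    and \<epsilon>_pos: "\<epsilon> > 0" and \<delta>: "0 < \<delta>" "\<delta> < 1" and \<nu>_pos: "\<nu> > 0"
  shows
    "let \<phi> = sqrt (\<nu> * real DIM('a) * ln (1 / \<delta>)) / (real n * \<epsilon>);
         \<tau> = G * (G / (\<gamma>\<^sup>2 * C * sqrt L)) powr (1 / (2 * k - 1))
               * (1 / real T + \<phi>\<^sup>2) powr (- (1 / (2 * (2 * k - 1))));
         \<eta> = C / (real T * \<tau> * sqrt L) * (1 / real T + \<phi>\<^sup>2) powr (- (1 / 2));
         \<sigma>2 = \<nu> * real T * ln (1 / \<delta>) * \<tau>\<^sup>2 / ((real n)\<^sup>2 * \<epsilon>\<^sup>2)
     in \<exists>A \<in> sets (PiM {..<n} (\<lambda>_. D)).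
          measure (PiM {..<n} (\<lambda>_. D)) A \<ge> 1 - \<gamma> \<and>
          (\<forall>Z \<in> A.
             (\<forall>w w'. norm (emp_grad gl Z n w - emp_grad gl Z n w') \<le> L * norm (w - w')) \<and>
             (\<exists>wstar. \<forall>w. emp_risk loss Z n wstar \<le> emp_risk loss Z n w)
             \<longrightarrow>
             (let fmin = (INF w. emp_risk loss Z n w);
                  OR = dpsgd_OR gl Z n b \<tau> (\<lambda>_. \<eta>) \<sigma>2 w0 T
              in OR \<le> ennreal ((sqrt L) powr (1 - 1 / (2 * k - 1)) * G powr (1 + 1 / (2 * k - 1))
                          / (\<gamma> powr (2 / (2 * k - 1)) * C powr (1 / (2 * k - 1)))
                          * (3 * C + 2 * (emp_risk loss Z n w0 - fmin) / C)
                          * (1 / real T + \<phi>\<^sup>2) powr (1 / 2 * (1 - 1 / (2 * k - 1))))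
                 \<and> (real T = 1 / \<phi>\<^sup>2 \<longrightarrow>
                    OR \<le> ennreal ((sqrt (2 * L)) powr (1 - 1 / (2 * k - 1)) * G powr (1 + 1 / (2 * k - 1))
                          / (\<gamma> powr (2 / (2 * k - 1)) * C powr (1 / (2 * k - 1)))
                          * (3 * C + 2 * (emp_risk loss Z n w0 - fmin) / C)
                          * \<phi> powr (1 - 1 / (2 * k - 1))))))"
proof -
  define r where "r = 1 / (2 * k - 1)"
  define \<phi> where "\<phi> = sqrt (\<nu> * real DIM('a) * ln (1 / \<delta>)) / (real n * \<epsilon>)"
  define \<psi> where "\<psi> = 1 / real T + \<phi>\<^sup>2"
  define \<tau> where "\<tau> = G * (G / (\<gamma>\<^sup>2 * C * sqrt L)) powr (1 / (2 * k - 1))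
    * \<psi> powr (- (1 / (2 * (2 * k - 1))))"
  define \<eta> where "\<eta> = C / (real T * \<tau> * sqrt L) * \<psi> powr (- (1 / 2))"
  define \<sigma>2 where "\<sigma>2 = \<nu> * real T * ln (1 / \<delta>) * \<tau>\<^sup>2 / ((real n)\<^sup>2 * \<epsilon>\<^sup>2)"
  define q where "q = \<psi> powr (1 / 2)"
  define B where "B = G powr k / (\<gamma> * \<tau> powr (k - 1))"
  have ln_pos: "ln (1 / \<delta>) > 0" using \<delta> by simp
  have T0: "real T > 0" and n0: "real n > 0" using T_ge n_ge by auto
  have \<phi>_pos: "\<phi> > 0"
    unfolding \<phi>_def using \<nu>_pos ln_pos n0 \<epsilon>_pos by simp
  have \<psi>_pos: "\<psi> > 0"
    using T0 by (simp add: \<psi>_def add_pos_nonneg)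
  have \<tau>_pos: "\<tau> > 0"
    unfolding \<tau>_def using G_pos \<gamma> C_pos L_pos \<psi>_pos by simp
  have \<eta>_pos: "\<eta> > 0"
    unfolding \<eta>_def using T0 \<tau>_pos L_pos C_pos \<psi>_pos by simp
  have \<sigma>2_pos: "\<sigma>2 > 0"
    unfolding \<sigma>2_def using \<nu>_pos T0 ln_pos \<tau>_pos n0 \<epsilon>_pos by simp
  have q_pos: "q > 0" and q_sq: "q * q = \<psi>"
    using \<psi>_pos by (auto simp: q_def simp flip: powr_add)
  \<comment> \<open>\<phi>^2 collects the dimension, privacy and sample-size factors, so the total
    noise variance is a multiple of \<tau>^2.\<close>
  have noise_var: "real DIM('a) * \<sigma>2 = real T * \<phi>\<^sup>2 * \<tau>\<^sup>2"
    using \<nu>_pos ln_pos by (simp add: \<phi>_def \<sigma>2_def power_divide power_mult_distrib)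
  have clip_bias: "B\<^sup>2 = \<tau> * C * sqrt L * q"
    and scale: "\<tau> * sqrt L * q = (sqrt L) powr (1 - r) * G powr (1 + r)
      / (\<gamma> powr (2 / (2 * k - 1)) * C powr r) * \<psi> powr (1 / 2 * (1 - r))"
    using tuned_clip_norm_identities[of G \<gamma> C "sqrt L" \<psi> k] G_pos \<gamma> C_pos L_pos \<psi>_pos k_gt
    by (simp_all add: B_def q_def \<tau>_def r_def)

  have G_moment: "(\<integral>z. Gf z powr k \<partial>D) \<le> G powr k"
  proof -
    have "((\<integral>z. Gf z powr k \<partial>D) powr (1 / k)) powr k \<le> G powr k"
      using moment k_gt by (intro powr_mono2) auto
    then show ?thesis
      using k_gt by (simp add: powr_powr integral_nonneg_AE)
  qed
  obtain A where A: "A \<in> sets (PiM {..<n} (\<lambda>_. D))" "measure (PiM {..<n} (\<lambda>_. D)) A \<ge> 1 - \<gamma>"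
    and A_pt: "\<And>Z i. Z \<in> A \<Longrightarrow> i < n \<Longrightarrow> Z i \<in> space D \<and> (\<forall>w. norm (gl w (Z i)) \<le> Gf (Z i))"
    and A_mean: "\<And>Z. Z \<in> A \<Longrightarrow> (1 / real n) * (\<Sum>i<n. Gf (Z i) powr k) \<le> G powr k / \<gamma>"
    using empirical_mean_event[OF D_prob Gf_int _ G_moment _ \<gamma>(1) n_ge grad_bound] G_pos by auto

  have OR: "dpsgd_OR gl Z n b \<tau> (\<lambda>_. \<eta>) \<sigma>2 w0 T
      \<le> ennreal (\<tau> * sqrt L * q * (3 * C + 2 * (emp_risk loss Z n w0 - (INF w. emp_risk loss Z n w)) / C))"
    if "Z \<in> A"
      and lip: "\<And>w w'. norm (emp_grad gl Z n w - emp_grad gl Z n w') \<le> L * norm (w - w')"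
      and attained: "\<And>w. emp_risk loss Z n wstar \<le> emp_risk loss Z n w" for Z wstar
  proof -
    define fmin where "fmin = (INF w. emp_risk loss Z n w)"
    define F where "F w = emp_risk loss Z n w - fmin" for w
    \<comment> \<open>An infimum of reals is a lower bound only for a set bounded below; the
      attained minimum guarantees this.\<close>
    have "bdd_below (range (emp_risk loss Z n))"
      using attained by (auto intro!: bdd_belowI)
    then have F_nonneg: "F w \<ge> 0" for w
      unfolding F_def fmin_def by (simp add: cINF_lower)
    have deriv_Z: "((\<lambda>w. loss w (Z i)) has_derivative (\<lambda>h. gl w (Z i) \<bullet> h)) (at w)" if "i < n" for i w
      using A_pt[OF \<open>Z \<in> A\<close> that] deriv by blast
    have F_deriv: "(F has_derivative (\<lambda>h. emp_grad gl Z n w \<bullet> h)) (at w)" for w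
      unfolding F_def emp_risk_def emp_grad_def inner_scaleR_left inner_sum_left
      by (rule derivative_eq_intros deriv_Z refl | simp)+
    have bias: "norm (emp_grad gl Z n w - (1 / real n) *\<^sub>R (\<Sum>i<n. clip (gl w (Z i)) \<tau>)) \<le> B" for w
    proof -
      have "norm (emp_grad gl Z n w - (1 / real n) *\<^sub>R (\<Sum>i<n. clip (gl w (Z i)) \<tau>))
          = (1 / real n) * norm (\<Sum>i<n. gl w (Z i) - clip (gl w (Z i)) \<tau>)"
        by (simp add: emp_grad_def sum_subtractf flip: scaleR_diff_right)
      also have "\<dots> \<le> (1 / real n) * (\<Sum>i<n. Gf (Z i) powr k / \<tau> powr (k - 1))"
      proof (intro mult_left_mono sum_norm_le)
        fix i assume "i \<in> {..<n}"
        then have "norm (gl w (Z i)) \<le> Gf (Z i)"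
          using A_pt[OF \<open>Z \<in> A\<close>] by simp
        then have "norm (gl w (Z i) - clip (gl w (Z i)) \<tau>) \<le> max 0 (Gf (Z i) - \<tau>)"
          using \<tau>_pos by (simp add: norm_clip_diff max_def)
        also have "\<dots> \<le> Gf (Z i) powr k / \<tau> powr (k - 1)"
          using Gf_nonneg \<tau>_pos k_gt by (intro excess_le_powr) auto
        finally show "norm (gl w (Z i) - clip (gl w (Z i)) \<tau>) \<le> Gf (Z i) powr k / \<tau> powr (k - 1)" .
      qed simp
      also have "\<dots> = (1 / real n) * (\<Sum>i<n. Gf (Z i) powr k) / \<tau> powr (k - 1)"
        by (simp add: sum_divide_distrib mult.commute)
      also have "\<dots> \<le> G powr k / \<gamma> / \<tau> powr (k - 1)"
        using A_mean[OF \<open>Z \<in> A\<close>] by (intro divide_right_mono) auto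
      finally show ?thesis by (simp add: B_def)
    qed
    have "dpsgd_OR gl Z n b \<tau> (\<lambda>_. \<eta>) \<sigma>2 w0 T
        \<le> ennreal (2 * F w0 / (real T * \<eta>) + B\<^sup>2 + L * \<eta> * (2 * \<tau>\<^sup>2 + real DIM('a) * \<sigma>2))"
      using F_nonneg F_deriv lip borel_measurable_gradient[OF deriv_Z] bias b \<eta>_pos \<sigma>2_pos L_pos \<tau>_pos T_ge
      by (intro dpsgd_OR_le) auto
    also have "\<dots> \<le> ennreal (\<tau> * sqrt L * q * (3 * C + 2 * F w0 / C))"
    proof (rule ennreal_leI)
      have \<eta>: "\<eta> = C / (real T * \<tau> * sqrt L * q)"
        by (simp add: \<eta>_def q_def powr_minus_divide)
      have "2 * F w0 / (real T * \<eta>) = \<tau> * sqrt L * q * (2 * F w0 / C)"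
        using T0 C_pos \<tau>_pos L_pos q_pos by (simp add: \<eta> field_simps)
      moreover have "L * \<eta> * (2 * \<tau>\<^sup>2 + real DIM('a) * \<sigma>2) \<le> \<tau> * sqrt L * q * (2 * C)"
      proof -
        have "L * \<eta> * (2 * \<tau>\<^sup>2 + real DIM('a) * \<sigma>2)
            = (sqrt L * sqrt L) * \<eta> * (\<tau> * \<tau> * (2 + real T * \<phi>\<^sup>2))"
          using L_pos unfolding noise_var by (simp add: power2_eq_square algebra_simps)
        also have "\<dots> = sqrt L * C * \<tau> * ((2 / real T + \<phi>\<^sup>2) / q)"
        proof -
          \<comment> \<open>With s in place of sqrt L this is an identity of rational
            functions.\<close>
          have "(s * s) * (C / (real T * \<tau> * s * q)) * (\<tau> * \<tau> * (2 + real T * \<phi>\<^sup>2))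
              = s * C * \<tau> * ((2 / real T + \<phi>\<^sup>2) / q)" if "s > 0" for s
            using T0 \<tau>_pos q_pos that by (simp add: divide_simps)
          then show ?thesis
            unfolding \<eta> using L_pos by (meson real_sqrt_gt_zero)
        qed
        also have "\<dots> \<le> sqrt L * C * \<tau> * (2 * q)"
        proof (intro mult_left_mono)
          \<comment> \<open>Doubling \<phi>^2 completes the sum to 2 \<psi>; this yields the share 2
            C, while \<open>clip_bias\<close> supplies the remaining C.\<close>
          have "2 / real T + \<phi>\<^sup>2 \<le> 2 * q * q"
            unfolding mult.assoc q_sq \<psi>_def by (simp add: distrib_left)
          then show "(2 / real T + \<phi>\<^sup>2) / q \<le> 2 * q"
            using q_pos by (simp add: divide_le_eq)
        qed (use L_pos C_pos \<tau>_pos in auto)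
        finally show ?thesis by (simp add: mult_ac)
      qed
      ultimately show "2 * F w0 / (real T * \<eta>) + B\<^sup>2 + L * \<eta> * (2 * \<tau>\<^sup>2 + real DIM('a) * \<sigma>2)
          \<le> \<tau> * sqrt L * q * (3 * C + 2 * F w0 / C)"
        unfolding clip_bias by (simp add: algebra_simps)
    qed
    finally show ?thesis by (simp add: F_def fmin_def)
  qed

  have rate: "\<tau> * sqrt L * q * x = (sqrt L) powr (1 - r) * G powr (1 + r)
      / (\<gamma> powr (2 / (2 * k - 1)) * C powr r) * x * \<psi> powr (1 / 2 * (1 - r))" for x
    unfolding scale by simp
  have rate': "\<tau> * sqrt L * q * x = (sqrt (2 * L)) powr (1 - r) * G powr (1 + r)
      / (\<gamma> powr (2 / (2 * k - 1)) * C powr r) * x * \<phi> powr (1 - r)" if "real T = 1 / \<phi>\<^sup>2" for x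
  proof -
    \<comment> \<open>For T = 1 / \<phi>^2 both summands of \<psi> coincide, and the resulting sqrt
      2 merges with sqrt L into sqrt (2 L).\<close>
    have "\<psi> = (sqrt 2 * \<phi>)\<^sup>2"
      using that by (simp add: \<psi>_def power_mult_distrib)
    then have "\<psi> powr (1 / 2) = sqrt 2 * \<phi>"
      using \<phi>_pos by (simp add: powr_half_sqrt)
    then have "\<psi> powr (1 / 2 * (1 - r)) = (sqrt 2 * \<phi>) powr (1 - r)"
      by (metis powr_powr)
    then show ?thesis
      using \<phi>_pos L_pos unfolding rate by (simp add: powr_mult real_sqrt_mult)
  qed
  show ?thesis
    \<comment> \<open>The abbreviations are folded from the inside out. \<open>r\<close> comes last,
      because \<tau> is defined with the exponent 1 / (2 k - 1) written out.\<close>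
    unfolding Let_def
    unfolding \<phi>_def[symmetric]
    unfolding \<psi>_def[symmetric]
    unfolding \<tau>_def[symmetric]
    unfolding \<eta>_def[symmetric] \<sigma>2_def[symmetric]
    unfolding r_def[symmetric]
    by (intro bexI[of _ A] conjI ballI impI; (elim conjE exE)?;
        (simp only: rate[symmetric] rate'[symmetric])?; (rule A | rule OR; blast))
qed

end
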